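(* Let $u,v\in\mathbb{N}\cup\{\omega\}$ and let $A$ be a $u\times v$ matrix with rational entries. Then there exist $J\subseteq u$ and a $J\times u$ matrix $B$ (with rational entries) such that $$\{\vec y\in(\mathbb{Q}\setminus\{0\})^u:B\vec y=\vec 0\}=\{A\vec x:\vec x\in\mathbb{Q}^v\}\cap(\mathbb{Q}\setminus\{0\})^u.$$ Further, $A$ is weakly image partition regular over $\mathbb{Q}$ if and only if $B$ is kernel partition regular over $\mathbb{Q}$.
   Context: $\mathbb{N}$ is the set of positive integers, $\omega=\{0,1,2,\dots\}$; each $u\in\mathbb{N}$ is identified with $\{0,\dots,u-1\}$, a matrix indexed by $J\times u$ has rows indexed by $J$ and columns by $u$, and all matrices considered have finitely many nonzero entries in each row. A finite colouring is a function with finite range; monochromatic means constant colour. $A$ is weakly image partition regular over $\mathbb{Q}$ if for every finite colouring of $\mathbb{Q}\setminus\{0\}$ there is $\vec x\in\mathbb{Q}^v$ with the entries of $A\vec x$ in $\mathbb{Q}\setminus\{0\}$ and monochromatic. $B$ is kernel partition regular over $\mathbb{Q}$ if for every finite colouring of $\mathbb{Q}\setminus\{0\}$ there is $\vec y\in(\mathbb{Q}\setminus\{0\})^u$ with $B\vec y=\vec 0$ and the entries of $\vec y$ monochromatic. *)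

theory Defs
  imports Complex_Main "HOL-Library.Extended_Nat" "HOL-Library.FuncSet"
begin

text \<open>
  An element \<open>u\<close> of \<open>\<nat> \<union> {\<omega>}\<close> is a nonzero \<^typ>\<open>enat\<close>, identified with the set of its
  predecessors. Vectors and matrix-vector products are extensional functions on their index set,
  so that equality of vectors only concerns genuine entries; the values of a matrix
  \<open>nat \<Rightarrow> nat \<Rightarrow> rat\<close> outside its index set are never used.
\<close>

definition index_set :: "enat \<Rightarrow> nat set" where
  "index_set u = {i. enat i < u}"

definition row_finite :: "nat set \<Rightarrow> nat set \<Rightarrow> (nat \<Rightarrow> nat \<Rightarrow> rat) \<Rightarrow> bool" where
  "row_finite R C M \<longleftrightarrow> (\<forall>i\<in>R. finite {j \<in> C. M i j \<noteq> 0})"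

text \<open>The sum is restricted to the support of the row because \<^const>\<open>sum\<close> is \<open>0\<close> on infinite sets.\<close>

definition mat_vec ::
  "nat set \<Rightarrow> nat set \<Rightarrow> (nat \<Rightarrow> nat \<Rightarrow> rat) \<Rightarrow> (nat \<Rightarrow> rat) \<Rightarrow> (nat \<Rightarrow> rat)" where
  "mat_vec R C M x = (\<lambda>i\<in>R. \<Sum>j\<in>{j \<in> C. M i j \<noteq> 0}. M i j * x j)"

text \<open>Colours are natural numbers; since a colouring has finite range this loses no generality.\<close>

definition finite_colouring :: "(rat \<Rightarrow> nat) \<Rightarrow> bool" where
  "finite_colouring c \<longleftrightarrow> finite (c ` (UNIV - {0}))"

definition monochromatic :: "(rat \<Rightarrow> nat) \<Rightarrow> nat set \<Rightarrow> (nat \<Rightarrow> rat) \<Rightarrow> bool" where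
  "monochromatic c I y \<longleftrightarrow> (\<exists>k. \<forall>i\<in>I. c (y i) = k)"

definition weakly_image_partition_regular ::
  "nat set \<Rightarrow> nat set \<Rightarrow> (nat \<Rightarrow> nat \<Rightarrow> rat) \<Rightarrow> bool" where
  "weakly_image_partition_regular R C M \<longleftrightarrow>
    (\<forall>c. finite_colouring c \<longrightarrow>
      (\<exists>x \<in> C \<rightarrow>\<^sub>E UNIV.
        mat_vec R C M x \<in> R \<rightarrow>\<^sub>E (UNIV - {0}) \<and> monochromatic c R (mat_vec R C M x)))"

definition kernel_partition_regular ::
  "nat set \<Rightarrow> nat set \<Rightarrow> (nat \<Rightarrow> nat \<Rightarrow> rat) \<Rightarrow> bool" where
  "kernel_partition_regular R C M \<longleftrightarrow>
    (\<forall>c. finite_colouring c \<longrightarrow>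
      (\<exists>y \<in> C \<rightarrow>\<^sub>E (UNIV - {0}). mat_vec R C M y = (\<lambda>i\<in>R. 0) \<and> monochromatic c C y))"

end

theory Submission
  imports Defs "HOL-Library.Function_Algebras"
begin

text \<open>
  Let \<open>J\<close> be the set of those \<open>j\<close> for which row \<open>j\<close> of \<open>A\<close> is a linear combination
  of the preceding rows, and let row \<open>j\<close> of \<open>B\<close> express this dependency. Images of \<open>A\<close> clearly lie
  in the kernel of \<open>B\<close>. Conversely, the rows with index outside \<open>J\<close> are linearly independent, so for
  \<open>y\<close> in the kernel some linear functional maps each of them to the corresponding entry of \<open>y\<close>, and
  the dependencies recorded in \<open>B\<close> force the same for the remaining rows. On finitely supported
  vectors a linear functional is the product with a vector \<open>x\<close>, whence \<open>A x = y\<close>.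
\<close>

text \<open>The coefficients belong to indices rather than to vectors, because distinct rows of a
  matrix may coincide and a kernel equation assigns one coefficient to each row index.\<close>

lemma (in vector_space) span_image_finiteE:
  assumes "finite F" "x \<in> span (a ` F)"
  obtains c where "x = (\<Sum>k\<in>F. c k *s a k)"
proof -
  have "\<exists>c. x = (\<Sum>k\<in>F. c k *s a k)"
    using assms
  proof (induction F arbitrary: x rule: finite_induct)
    case empty
    then show ?case by simp
  next
    case (insert m F)
    then obtain r where "x - r *s a m \<in> span (a ` F)"
      by (auto simp: span_insert)
    then obtain c where c: "x - r *s a m = (\<Sum>k\<in>F. c k *s a k)"
      using insert.IH by blast
    have "(\<Sum>k\<in>insert m F. (c(m := r)) k *s a k) = r *s a m + (\<Sum>k\<in>F. (c(m := r)) k *s a k)"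
      using insert.hyps by simp
    also have "(\<Sum>k\<in>F. (c(m := r)) k *s a k) = (\<Sum>k\<in>F. c k *s a k)"
      using insert.hyps by (intro sum.cong) auto
    also have "r *s a m + \<dots> = x"
      by (simp flip: c)
    finally show ?case by metis
  qed
  then show thesis using that by blast
qed

text \<open>Adjoining a vector outside the span of an independent set keeps it independent, so every
  initial segment is independent. These segments form a chain, and independence passes to the union
  of a chain.\<close>

lemma (in vector_space) independent_if_notin_span_preceding:
  fixes a :: "nat \<Rightarrow> 'b"
  assumes "\<And>i. i \<in> I \<Longrightarrow> a i \<notin> span (a ` {k \<in> I. k < i})"
  shows "independent (a ` I)"
proof -
  have ind: "independent (a ` {k \<in> I. k < n})" for n
  proof (induction n)
    case 0
    then show ?case by (simp add: independent_empty)
  next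
    case (Suc n)
    show ?case
    proof (cases "n \<in> I")
      case True
      then have "{k \<in> I. k < Suc n} = insert n {k \<in> I. k < n}" by auto
      then show ?thesis
        using Suc assms[OF True] by (simp add: independent_insertI)
    next
      case False
      then have "{k \<in> I. k < Suc n} = {k \<in> I. k < n}" by (auto simp: less_Suc_eq)
      then show ?thesis using Suc by simp
    qed
  qed
  have "independent (\<Union> (range (\<lambda>n. a ` {k \<in> I. k < n})))"
  proof (rule independent_Union_directed)
    fix c d
    assume "c \<in> range (\<lambda>n. a ` {k \<in> I. k < n})" "d \<in> range (\<lambda>n. a ` {k \<in> I. k < n})"
    then obtain m n where "c = a ` {k \<in> I. k < m}" "d = a ` {k \<in> I. k < n}" by blast
    then show "c \<subseteq> d \<or> d \<subseteq> c"
      by (cases "m \<le> n") (auto intro!: imageI)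
  qed (use ind in auto)
  also have "\<Union> (range (\<lambda>n. a ` {k \<in> I. k < n})) = a ` I" by auto
  finally show ?thesis .
qed

text \<open>One relation per dependent index suffices: \<open>f\<close> is prescribed freely at the
  indices not spanned by their predecessors, and strong induction along the shared relations forces
  the remaining values.\<close>

lemma (in vector_space_pair) linear_extend_preceding_relations:
  fixes a :: "nat \<Rightarrow> 'b" and y :: "nat \<Rightarrow> 'c"
  assumes rel: "\<And>j. j \<in> R \<Longrightarrow> a j \<in> vs1.span (a ` {k \<in> R. k < j}) \<Longrightarrow>
      \<exists>c. a j = (\<Sum>k\<in>{k \<in> R. k < j}. s1 (c k) (a k)) \<and>
          y j = (\<Sum>k\<in>{k \<in> R. k < j}. s2 (c k) (y k))"
  obtains f where "Vector_Spaces.linear s1 s2 f" "\<And>i. i \<in> R \<Longrightarrow> f (a i) = y i"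
proof -
  define I where "I = {i \<in> R. a i \<notin> vs1.span (a ` {k \<in> R. k < i})}"
  have notin: "a i \<notin> vs1.span (a ` {k \<in> I. k < i})" if "i \<in> I" for i
  proof -
    have "vs1.span (a ` {k \<in> I. k < i}) \<subseteq> vs1.span (a ` {k \<in> R. k < i})"
      by (intro vs1.span_mono image_mono) (auto simp: I_def)
    then show ?thesis using that by (auto simp: I_def)
  qed
  \<comment> \<open>A repeated value would put \<open>a i\<close> in the span of preceding vectors.
    Injectivity lets \<open>inv_into I a\<close> recover the index, so the value prescribed at
    \<open>a i\<close> is \<open>y i\<close>.\<close>
  have "a i \<noteq> a k" if "i \<in> I" "k \<in> I" "k < i" for i k
    using notin[OF that(1)] that vs1.span_base[of "a k" "a ` {k \<in> I. k < i}"] by auto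
  then have inj: "inj_on a I"
    by (metis inj_onI linorder_neqE_nat)
  have "vs1.independent (a ` I)"
    using notin by (rule vs1.independent_if_notin_span_preceding)
  from linear_independent_extend[OF this, of "\<lambda>x. y (inv_into I a x)"]
  obtain f where f: "Vector_Spaces.linear s1 s2 f" "\<forall>x\<in>a ` I. f x = y (inv_into I a x)"
    by blast
  have "f (a i) = y i" if "i \<in> R" for i
    using that
  proof (induction i rule: less_induct)
    case (less i)
    interpret f: Vector_Spaces.linear s1 s2 f by fact
    show ?case
    proof (cases "i \<in> I")
      case True
      then show ?thesis using f(2) inj by simp
    next
      case False
      with less.prems have "a i \<in> vs1.span (a ` {k \<in> R. k < i})" by (simp add: I_def)
      from rel[OF less.prems this] obtain c
        where c: "a i = (\<Sum>k\<in>{k \<in> R. k < i}. s1 (c k) (a k))"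
          "y i = (\<Sum>k\<in>{k \<in> R. k < i}. s2 (c k) (y k))" by blast
      have "f (a i) = (\<Sum>k\<in>{k \<in> R. k < i}. s2 (c k) (f (a k)))"
        unfolding c(1) by (simp add: f.sum f.scale)
      also have "\<dots> = y i"
        unfolding c(2) using less.IH by (intro sum.cong) auto
      finally show ?thesis .
    qed
  qed
  then show thesis using that f(1) by blast
qed

abbreviation (input) scale_fun :: "rat \<Rightarrow> (nat \<Rightarrow> rat) \<Rightarrow> nat \<Rightarrow> rat" where
  "scale_fun r f \<equiv> (\<lambda>i. r * f i)"

text \<open>With \<open>rat\<close> itself as the second space, the linear maps of this pair are the
  linear functionals on rational sequences.\<close>

interpretation fun_rat: vector_space_pair scale_fun "(*) :: rat \<Rightarrow> rat \<Rightarrow> rat"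
  by unfold_locales (auto simp: fun_eq_iff algebra_simps)

lemma sum_fun_apply: "(\<Sum>k\<in>F. g k) x = (\<Sum>k\<in>F. g k x)"
  for g :: "'k \<Rightarrow> 'a \<Rightarrow> 'b::comm_monoid_add"
  by (induction F rule: infinite_finite_induct) auto

text \<open>A finitely supported \<open>w\<close> is a finite combination of the unit vectors
  \<open>\<lambda>i. of_bool (i = k)\<close>, so linearity turns \<open>f\<close> into a dot
  product. Row finiteness enters here.\<close>

lemma linear_functional_finite_support:
  assumes "Vector_Spaces.linear scale_fun (*) f" and fin: "finite S"
    and supp: "\<And>k. k \<notin> S \<Longrightarrow> w k = 0"
  shows "f w = (\<Sum>k\<in>S. w k * f (\<lambda>i. of_bool (i = k)))"
proof -
  interpret f: Vector_Spaces.linear scale_fun "(*)" f by fact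
  have "w = (\<Sum>k\<in>S. scale_fun (w k) (\<lambda>i. of_bool (i = k)))"
  proof
    fix i
    have "(\<Sum>k\<in>S. w k * of_bool (i = k)) = (if i \<in> S then w i else 0)"
      using fin by (simp add: of_bool_def if_distrib cong: if_cong)
    then show "w i = (\<Sum>k\<in>S. scale_fun (w k) (\<lambda>i. of_bool (i = k))) i"
      using supp by (auto simp: sum_fun_apply)
  qed
  then have "f w = f (\<Sum>k\<in>S. scale_fun (w k) (\<lambda>i. of_bool (i = k)))" by simp
  then show ?thesis by (simp add: f.sum f.scale)
qed

text \<open>Entries of \<open>y\<close> may vanish here: the whole image is a kernel, and the
  restriction to nonzero entries is imposed only afterwards.\<close>

lemma image_eq_kernel:
  assumes fin: "row_finite R C A"
  obtains J B where "J \<subseteq> R" "row_finite J R B"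
    "\<And>y. y \<in> extensional R \<Longrightarrow>
      mat_vec J R B y = (\<lambda>i\<in>J. 0) \<longleftrightarrow> (\<exists>x \<in> C \<rightarrow>\<^sub>E UNIV. y = mat_vec R C A x)"
proof -
  \<comment> \<open>Values of \<open>A\<close> outside the columns \<open>C\<close> are arbitrary;
    replacing them by zero makes linear dependence of rows concern genuine entries only.\<close>
  define a where "a i k = (if k \<in> C then A i k else 0)" for i k
  define P where "P j = {k \<in> R. k < j}" for j
  define J where "J = {j \<in> R. a j \<in> fun_rat.vs1.span (a ` P j)}"
  define S where "S i = {k \<in> C. A i k \<noteq> 0}" for i
  have finP: "finite (P j)" for j by (simp add: P_def)
  have finS: "finite (S i)" if "i \<in> R" for i
    using fin that by (simp add: row_finite_def S_def)
  have "\<exists>c. a j = (\<Sum>k\<in>P j. scale_fun (c k) (a k))" if "j \<in> J" for j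
    using fun_rat.vs1.span_image_finiteE[OF finP] that unfolding J_def by blast
  then obtain c where c: "\<And>j. j \<in> J \<Longrightarrow> a j = (\<Sum>k\<in>P j. scale_fun (c j k) (a k))"
    by metis
  \<comment> \<open>Row \<open>j\<close> encodes the equation
    \<open>y j = (\<Sum>k\<in>P j. c j k * y k)\<close>, and its support within \<open>R\<close>
    lies in the finite set \<open>insert j (P j)\<close>.\<close>
  define B where "B j k = (if k = j then 1 else if k < j then - c j k else 0)" for j k
  have supp: "{k \<in> R. B j k \<noteq> 0} \<subseteq> insert j (P j)" for j
    by (auto simp: B_def P_def split: if_splits)
  have rowB: "mat_vec J R B y j = y j - (\<Sum>k\<in>P j. c j k * y k)" if "j \<in> J" for j y
  proof -
    have "j \<in> R" using that by (simp add: J_def)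
    then have "(\<Sum>k\<in>{k \<in> R. B j k \<noteq> 0}. B j k * y k) = (\<Sum>k\<in>insert j (P j). B j k * y k)"
      using supp finP by (intro sum.mono_neutral_left) (auto simp: P_def)
    then have "mat_vec J R B y j = (\<Sum>k\<in>insert j (P j). B j k * y k)"
      using that by (simp add: mat_vec_def)
    also have "\<dots> = y j + (\<Sum>k\<in>P j. - (c j k * y k))"
      using finP by (auto simp: P_def B_def intro!: sum.cong)
    finally show ?thesis by (simp add: sum_negf)
  qed
  have kerB: "mat_vec J R B y = (\<lambda>i\<in>J. 0) \<longleftrightarrow> (\<forall>j\<in>J. y j = (\<Sum>k\<in>P j. c j k * y k))" for y
  proof -
    have "mat_vec J R B y = (\<lambda>i\<in>J. 0) \<longleftrightarrow> (\<forall>j\<in>J. mat_vec J R B y j = 0)"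
      by (auto simp: fun_eq_iff mat_vec_def)
    then show ?thesis by (simp add: rowB)
  qed
  \<comment> \<open>Allowing any finite \<open>T\<close> above the support lets several rows be
    summed over one common index set.\<close>
  have rowA: "mat_vec R C A x i = (\<Sum>k\<in>T. a i k * x k)"
    if "i \<in> R" "finite T" "S i \<subseteq> T" for i x T
  proof -
    have "(\<Sum>k\<in>S i. A i k * x k) = (\<Sum>k\<in>S i. a i k * x k)"
      by (intro sum.cong) (auto simp: S_def a_def)
    also have "\<dots> = (\<Sum>k\<in>T. a i k * x k)"
      using that by (intro sum.mono_neutral_left) (auto simp: S_def a_def)
    finally show ?thesis using that by (simp add: mat_vec_def S_def)
  qed
  show thesis
  proof (rule that[of J B])
    show "J \<subseteq> R" by (auto simp: J_def)
    show "row_finite J R B"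
      unfolding row_finite_def using supp finP by (meson finite.insertI finite_subset)
    fix y :: "nat \<Rightarrow> rat"
    assume ext: "y \<in> extensional R"
    show "mat_vec J R B y = (\<lambda>i\<in>J. 0) \<longleftrightarrow> (\<exists>x \<in> C \<rightarrow>\<^sub>E UNIV. y = mat_vec R C A x)"
    proof
      assume ker: "mat_vec J R B y = (\<lambda>i\<in>J. 0)"
      obtain f where f: "Vector_Spaces.linear scale_fun (*) f" "\<And>i. i \<in> R \<Longrightarrow> f (a i) = y i"
      proof (rule fun_rat.linear_extend_preceding_relations[of R a y])
        fix j assume "j \<in> R" "a j \<in> fun_rat.vs1.span (a ` {k \<in> R. k < j})"
        then have "j \<in> J" by (simp add: J_def P_def)
        then show "\<exists>c. a j = (\<Sum>k\<in>{k \<in> R. k < j}. scale_fun (c k) (a k)) \<and>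
            y j = (\<Sum>k\<in>{k \<in> R. k < j}. c k * y k)"
          using c[of j] ker unfolding kerB P_def by blast
      qed blast
      \<comment> \<open>The preimage lists the values of \<open>f\<close> on the unit vectors, cut
        off to be extensional on \<open>C\<close>.\<close>
      define x where "x = (\<lambda>k\<in>C. f (\<lambda>i. of_bool (i = k)))"
      have "y i = mat_vec R C A x i" if "i \<in> R" for i
      proof -
        have "y i = (\<Sum>k\<in>S i. a i k * f (\<lambda>i. of_bool (i = k)))"
          unfolding f(2)[OF that, symmetric]
          by (rule linear_functional_finite_support[OF f(1) finS[OF that]])
            (auto simp: S_def a_def)
        also have "\<dots> = (\<Sum>k\<in>S i. a i k * x k)"
          by (intro sum.cong) (auto simp: x_def S_def)
        finally show ?thesis using rowA[OF that finS[OF that]] by simp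
      qed
      then have "y = mat_vec R C A x"
        using ext by (intro extensionalityI[of _ R]) (auto simp: mat_vec_def)
      then show "\<exists>x \<in> C \<rightarrow>\<^sub>E UNIV. y = mat_vec R C A x"
        by (intro bexI[of _ x]) (auto simp: x_def)
    next
      assume "\<exists>x \<in> C \<rightarrow>\<^sub>E UNIV. y = mat_vec R C A x"
      then obtain x where x: "y = mat_vec R C A x" by blast
      have "y j = (\<Sum>k\<in>P j. c j k * y k)" if "j \<in> J" for j
      proof -
        \<comment> \<open>A common finite support for row \<open>j\<close> and its predecessors,
          over which the two summations can be interchanged.\<close>
        define T where "T = (\<Union>i\<in>insert j (P j). S i)"
        have sub: "insert j (P j) \<subseteq> R" using that by (auto simp: J_def P_def)
        then have "finite T" unfolding T_def using finP finS by blast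
        then have y: "y i = (\<Sum>l\<in>T. a i l * x l)" if "i \<in> insert j (P j)" for i
          unfolding x using that sub by (intro rowA) (auto simp: T_def)
        have row: "a j l = (\<Sum>k\<in>P j. c j k * a k l)" for l
          using fun_cong[OF c[OF that], of l] by (simp only: sum_fun_apply)
        have "y j = (\<Sum>l\<in>T. a j l * x l)"
          by (rule y) simp
        also have "\<dots> = (\<Sum>l\<in>T. \<Sum>k\<in>P j. c j k * (a k l * x l))"
          by (simp only: row sum_distrib_right mult.assoc)
        also have "\<dots> = (\<Sum>k\<in>P j. \<Sum>l\<in>T. c j k * (a k l * x l))"
          by (rule sum.swap)
        also have "\<dots> = (\<Sum>k\<in>P j. c j k * y k)"
          by (intro sum.cong) (auto simp: y sum_distrib_left)
        finally show ?thesis .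
      qed
      then show "mat_vec J R B y = (\<lambda>i\<in>J. 0)" by (simp add: kerB)
    qed
  qed
qed

theorem theorem2p8:
  fixes u v :: enat and A :: "nat \<Rightarrow> nat \<Rightarrow> rat"
  assumes "u \<noteq> 0" and "v \<noteq> 0"
    and "row_finite (index_set u) (index_set v) A"
  shows "\<exists>J B. J \<subseteq> index_set u \<and> row_finite J (index_set u) B \<and>
    {y \<in> index_set u \<rightarrow>\<^sub>E (UNIV - {0}). mat_vec J (index_set u) B y = (\<lambda>i\<in>J. 0)} =
      {mat_vec (index_set u) (index_set v) A x | x. x \<in> index_set v \<rightarrow>\<^sub>E UNIV}
        \<inter> (index_set u \<rightarrow>\<^sub>E (UNIV - {0})) \<and>
    (weakly_image_partition_regular (index_set u) (index_set v) A \<longleftrightarrow>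
      kernel_partition_regular J (index_set u) B)"
proof -
  let ?R = "index_set u" and ?C = "index_set v"
  obtain J B where JB: "J \<subseteq> ?R" "row_finite J ?R B"
    and ker: "\<And>y. y \<in> extensional ?R \<Longrightarrow>
      mat_vec J ?R B y = (\<lambda>i\<in>J. 0) \<longleftrightarrow> (\<exists>x \<in> ?C \<rightarrow>\<^sub>E UNIV. y = mat_vec ?R ?C A x)"
    using image_eq_kernel[OF assms(3)] by blast
  have ker': "mat_vec J ?R B y = (\<lambda>i\<in>J. 0) \<longleftrightarrow> (\<exists>x \<in> ?C \<rightarrow>\<^sub>E UNIV. y = mat_vec ?R ?C A x)"
    if "y \<in> ?R \<rightarrow>\<^sub>E (UNIV - {0})" for y
    using that by (intro ker) (simp add: PiE_def)
  have "{y \<in> ?R \<rightarrow>\<^sub>E (UNIV - {0}). mat_vec J ?R B y = (\<lambda>i\<in>J. 0)} =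
      {mat_vec ?R ?C A x | x. x \<in> ?C \<rightarrow>\<^sub>E UNIV} \<inter> (?R \<rightarrow>\<^sub>E (UNIV - {0}))"
    using ker' by blast
  \<comment> \<open>Among vectors with nonzero entries, images under \<open>A\<close> and kernel
    vectors of \<open>B\<close> coincide, so for each colouring the same vectors witness both
    sides.\<close>
  moreover have "(\<exists>x \<in> ?C \<rightarrow>\<^sub>E UNIV. mat_vec ?R ?C A x \<in> ?R \<rightarrow>\<^sub>E (UNIV - {0}) \<and>
        monochromatic c ?R (mat_vec ?R ?C A x)) \<longleftrightarrow>
      (\<exists>y \<in> ?R \<rightarrow>\<^sub>E (UNIV - {0}). mat_vec J ?R B y = (\<lambda>i\<in>J. 0) \<and> monochromatic c ?R y)" for c
    using ker' by blast
  then have "weakly_image_partition_regular ?R ?C A \<longleftrightarrow> kernel_partition_regular J ?R B"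
    unfolding weakly_image_partition_regular_def kernel_partition_regular_def by simp
  ultimately show ?thesis using JB by (intro exI[of _ J] exI[of _ B] conjI)
qed

end
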